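(* Let $C=C_{\{\mathcal{I}_n,\mathcal{J}_n\}}\subset\mathbb{R}$ be a nice Cantor set which is $(\alpha_n)$-thick for some sequence $(\alpha_n)_{n\ge1}$, $0<\alpha_n<1$, such that $\sum_n\alpha_n^p<\infty$ for some $0<p<\infty$. Then there is a doubling measure $\mu$ on $\mathbb{R}$ with $\mu(C)>0$.
   Context: A measure means a Borel regular outer measure; $\mu$ on $\mathbb{R}$ is doubling if there is $c<\infty$ with $0<\mu(B(x,2r))\le c\,\mu(B(x,r))<\infty$ for all $x$, $r>0$. A Cantor construction $\{\mathcal{I}_n,\mathcal{J}_n\}_n$: for each $n\in\mathbb{N}$, $\mathcal{I}_n=\{I_{n,i}\}_i$ is a collection of closed intervals with mutually disjoint interiors and $\mathcal{J}_n=\{J_{n,i}\}_i$ a collection of open intervals with $J_{n,i}\subset I_{n,i}$, such that each $I_{n+1,i}$ is contained in some $I_{n,j}$, $\bigcup\mathcal{I}_{n+1}=\bigcup\mathcal{I}_n\setminus\bigcup\mathcal{J}_n$, $\sup_j|I_{n,j}|\to0$, and $\bigcup\mathcal{I}_1$ is bounded; $C=\bigcap_n\bigcup_iI_{n,i}$. Nice: there is $0<c<1$ with $cI_{n,i}\cap J_{n,i}\neq\emptyset$ for all $n,i$ ($cI$ the interval concentric with $I$ of length $c|I|$). $(\alpha_n)$-thick: $|J_{n,i}|\le\alpha_n|I_{n,i}|$ for all $n,i$. *)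

theory Defs
  imports "HOL-Analysis.Analysis"
begin

text \<open>A Cantor construction indexed by generations n \<ge> 1.  For generation n the
  collection I_n is given by an index set Ix n, and for i in Ix n the closed interval
  I_{n,i} = {a n i .. b n i} (with a n i \<le> b n i) and the open interval
  J_{n,i} = {c n i <..< d n i} (with c n i \<le> d n i).\<close>

definition cantor_construction ::
  "(nat \<Rightarrow> 'i set) \<Rightarrow> (nat \<Rightarrow> 'i \<Rightarrow> real) \<Rightarrow> (nat \<Rightarrow> 'i \<Rightarrow> real)
   \<Rightarrow> (nat \<Rightarrow> 'i \<Rightarrow> real) \<Rightarrow> (nat \<Rightarrow> 'i \<Rightarrow> real) \<Rightarrow> bool" where
  "cantor_construction Ix a b c d \<longleftrightarrow>
     (\<forall>n\<ge>1. \<forall>i\<in>Ix n. a n i \<le> b n i \<and> c n i \<le> d n i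
         \<and> {c n i<..<d n i} \<subseteq> {a n i..b n i}) \<and>
     (\<forall>n\<ge>1. \<forall>i\<in>Ix n. \<forall>j\<in>Ix n. i \<noteq> j \<longrightarrow>
         {a n i<..<b n i} \<inter> {a n j<..<b n j} = {}) \<and>
     (\<forall>n\<ge>1. \<forall>i\<in>Ix (Suc n). \<exists>j\<in>Ix n. {a (Suc n) i..b (Suc n) i} \<subseteq> {a n j..b n j}) \<and>
     (\<forall>n\<ge>1. (\<Union>i\<in>Ix (Suc n). {a (Suc n) i..b (Suc n) i}) =
         (\<Union>i\<in>Ix n. {a n i..b n i}) - (\<Union>i\<in>Ix n. {c n i<..<d n i})) \<and>
     (\<forall>\<epsilon>>0. \<exists>N. \<forall>n\<ge>N. \<forall>j\<in>Ix n. b n j - a n j \<le> \<epsilon>) \<and>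
     bounded (\<Union>i\<in>Ix 1. {a 1 i..b 1 i})"

definition cantor_set ::
  "(nat \<Rightarrow> 'i set) \<Rightarrow> (nat \<Rightarrow> 'i \<Rightarrow> real) \<Rightarrow> (nat \<Rightarrow> 'i \<Rightarrow> real) \<Rightarrow> real set" where
  "cantor_set Ix a b = (\<Inter>n\<in>{1..}. \<Union>i\<in>Ix n. {a n i..b n i})"

definition conc_interval :: "real \<Rightarrow> real \<Rightarrow> real \<Rightarrow> real set" where
  "conc_interval t x y = {(x+y)/2 - t*(y-x)/2 .. (x+y)/2 + t*(y-x)/2}"

definition nice_construction ::
  "(nat \<Rightarrow> 'i set) \<Rightarrow> (nat \<Rightarrow> 'i \<Rightarrow> real) \<Rightarrow> (nat \<Rightarrow> 'i \<Rightarrow> real)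
   \<Rightarrow> (nat \<Rightarrow> 'i \<Rightarrow> real) \<Rightarrow> (nat \<Rightarrow> 'i \<Rightarrow> real) \<Rightarrow> bool" where
  "nice_construction Ix a b c d \<longleftrightarrow>
     (\<exists>t. 0 < t \<and> t < 1 \<and> (\<forall>n\<ge>1. \<forall>i\<in>Ix n.
        conc_interval t (a n i) (b n i) \<inter> {c n i<..<d n i} \<noteq> {}))"

definition thick_construction ::
  "(nat \<Rightarrow> real) \<Rightarrow> (nat \<Rightarrow> 'i set) \<Rightarrow> (nat \<Rightarrow> 'i \<Rightarrow> real) \<Rightarrow> (nat \<Rightarrow> 'i \<Rightarrow> real)
   \<Rightarrow> (nat \<Rightarrow> 'i \<Rightarrow> real) \<Rightarrow> (nat \<Rightarrow> 'i \<Rightarrow> real) \<Rightarrow> bool" where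
  "thick_construction \<alpha> Ix a b c d \<longleftrightarrow>
     (\<forall>n\<ge>1. \<forall>i\<in>Ix n. d n i - c n i \<le> \<alpha> n * (b n i - a n i))"

definition doubling_measure :: "real measure \<Rightarrow> bool" where
  "doubling_measure M \<longleftrightarrow> sets M = sets borel \<and>
     (\<exists>C::real. \<forall>x r. r > 0 \<longrightarrow>
        0 < emeasure M (ball x (2*r)) \<and>
        emeasure M (ball x (2*r)) \<le> ennreal C * emeasure M (ball x r) \<and>
        emeasure M (ball x r) < \<infinity>)"

end

theory Submission
  imports Defs
begin

text \<open>The measure is a multiplicative cascade on a \<open>B\<close>-adic grid: every cell distributes its mass to
  its \<open>B\<close> children, with shares bounded below. If two neighbouring cells with different parents
  always receive the same share, then neighbouring masses of the same level are comparable, and the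
  measure is doubling.

  Niceness gives in every gap \<open>J\<close> a point \<open>z\<close> at distance at least \<open>\<eta> |I|\<close> from the boundary
  of its interval \<open>I\<close>. At all levels \<open>k\<close> with \<open>|J| \<le> B ^ -k \<le> \<eta> |I| / 2\<close> the cell containing \<open>z\<close>
  gets only the share \<open>B ^ -q\<close>, so \<open>J\<close> has mass at most a constant times
  \<open>(|J| / |I|) ^ q\<close> times the mass of \<open>I\<close>. These prescriptions do not interfere: a gap is
  disjoint from all later intervals, so the points \<open>z\<close>, \<open>z'\<close> of two gaps are at distance at least
  \<open>\<eta> min |I| |I'|\<close>, and a cell with \<open>B \<ge> 4\<close> children has at most one child with a prescribed share
  and an inner child to absorb the difference. With \<open>q \<ge> p\<close> the total mass of the gaps inside an
  interval of a late generation is smaller than the mass of that interval.\<close>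

section \<open>Doubling measures on the line\<close>

lemma emeasure_interval_measure_Ioo:
  fixes F :: "real \<Rightarrow> real"
  assumes "x \<le> y" and mono: "\<And>x y. x \<le> y \<Longrightarrow> F x \<le> F y" and cont: "continuous_on UNIV F"
  shows "emeasure (interval_measure F) {x<..<y} = ennreal (F y - F x)"
proof -
  have "{u} \<in> null_sets (interval_measure F)" for u
    using emeasure_interval_measure_Icc[OF order_refl mono cont, of u] by auto
  then have "{x} \<union> {y} \<in> null_sets (interval_measure F)"
    by (intro null_sets.Un)
  moreover have "{x<..<y} = {x..y} - ({x} \<union> {y})"
    by auto
  ultimately have "emeasure (interval_measure F) {x<..<y} = emeasure (interval_measure F) {x..y}"
    by (simp add: emeasure_Diff_null_set)
  then show ?thesis
    using emeasure_interval_measure_Icc[OF assms] by simp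
qed

lemma doubling_interval_measure:
  fixes F :: "real \<Rightarrow> real"
  assumes "strict_mono F" and cont: "continuous_on UNIV F"
    and doubling: "\<And>x r. 0 < r \<Longrightarrow> F (x + 2 * r) - F (x - 2 * r) \<le> C * (F (x + r) - F (x - r))"
  shows "doubling_measure (interval_measure F)"
proof -
  have mono: "F x \<le> F y" if "x \<le> y" for x y
    using assms(1) that by (simp add: strict_mono_less_eq)
  have ball: "emeasure (interval_measure F) (ball x r) = ennreal (F (x + r) - F (x - r))"
    if "0 < r" for x r
    using that
    by (simp add: ball_eq_greaterThanLessThan emeasure_interval_measure_Ioo[OF _ mono cont])
  show ?thesis
    unfolding doubling_measure_def
  proof (intro conjI exI[of _ C] allI impI)
    fix x r :: real
    assume r: "0 < r"
    have "F (x - 2 * r) < F (x + 2 * r)"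
      using r by (intro strict_monoD[OF assms(1)]) simp
    then show "0 < emeasure (interval_measure F) (ball x (2 * r))"
      using r by (simp add: ball ennreal_less_zero_iff)
    have "ennreal (F (x + 2 * r) - F (x - 2 * r)) \<le> ennreal (C * (F (x + r) - F (x - r)))"
      by (intro ennreal_leI doubling r)
    also have "\<dots> = ennreal C * ennreal (F (x + r) - F (x - r))"
      using r by (intro ennreal_mult'') (simp add: mono)
    finally show "emeasure (interval_measure F) (ball x (2 * r))
        \<le> ennreal C * emeasure (interval_measure F) (ball x r)"
      using r by (simp add: ball)
    show "emeasure (interval_measure F) (ball x r) < \<infinity>"
      using r by (simp add: ball)
  qed simp
qed

lemma doubling_measure_Icc:
  assumes "doubling_measure M" "x < y"
  shows "0 < emeasure M {x..y}" "emeasure M {x..y} < \<infinity>"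
proof -
  have sets: "sets M = sets borel"
    and ball: "r > 0 \<Longrightarrow> 0 < emeasure M (ball u (2 * r)) \<and> emeasure M (ball u r) < \<infinity>" for u r
    using assms(1) unfolding doubling_measure_def by blast+
  define u where "u = (x + y) / 2"
  define r where "r = (y - x) / 4"
  have "0 < r" using assms(2) by (simp add: r_def)
  have xy: "x = u - 2 * r" "y = u + 2 * r"
    by (simp_all add: u_def r_def field_simps)
  have "emeasure M (ball u (2 * r)) \<le> emeasure M {x..y}"
    by (intro emeasure_mono) (auto simp: xy dist_real_def sets)
  then show "0 < emeasure M {x..y}"
    using ball[OF \<open>0 < r\<close>, of u] by (auto intro: less_le_trans)
  have "emeasure M {x..y} \<le> emeasure M (ball u (3 * r))"
    using \<open>0 < r\<close> by (intro emeasure_mono) (auto simp: xy dist_real_def sets)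
  also have "\<dots> < \<infinity>" using ball[of "3 * r" u] \<open>0 < r\<close> by simp
  finally show "emeasure M {x..y} < \<infinity>" .
qed

section \<open>Adic grids\<close>

text \<open>The cell \<open>j\<close> of level \<open>k\<close> is the interval from \<open>grid_point k j\<close> to \<open>grid_point k (j + 1)\<close>;
  its parent is the cell \<open>j div B\<close> of level \<open>k - 1\<close>.\<close>
locale adic_grid =
  fixes B :: int
  assumes base_ge_2: "2 \<le> B"
begin

definition mesh :: "nat \<Rightarrow> real" where
  "mesh k = 1 / of_int B ^ k"

definition grid_point :: "nat \<Rightarrow> int \<Rightarrow> real" where
  "grid_point k j = of_int j * mesh k"

definition cell_index :: "nat \<Rightarrow> real \<Rightarrow> int" where
  "cell_index k x = \<lfloor>x / mesh k\<rfloor>"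

definition children :: "int \<Rightarrow> int set" where
  "children g = {B * g..<B * (g + 1)}"

lemma mesh_pos: "0 < mesh k"
  using base_ge_2 by (simp add: mesh_def)

lemma mesh_0 [simp]: "mesh 0 = 1"
  by (simp add: mesh_def)

lemma mesh_add: "mesh (k + n) = mesh k * (1 / of_int B) ^ n"
  by (simp add: mesh_def power_add power_divide)

lemma mesh_Suc: "mesh (Suc k) = mesh k / of_int B"
  using mesh_add[of k 1] by simp

lemma mesh_antimono: "k \<le> n \<Longrightarrow> mesh n \<le> mesh k"
  using base_ge_2 by (auto simp: mesh_def intro!: divide_left_mono power_increasing)

lemma mesh_between:
  assumes "0 < x" "x \<le> 1"
  obtains k where "x \<le> mesh k" "mesh k < of_int B * x"
proof -
  have "1 / real_of_int B < 1"
    using base_ge_2 by simp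
  then obtain n where "(1 / real_of_int B) ^ n < x"
    using real_arch_pow_inv[OF assms(1)] by blast
  then have n: "mesh n < x"
    by (simp add: mesh_def power_divide)
  define m where "m = (LEAST n. mesh n < x)"
  have m: "mesh m < x"
    unfolding m_def by (rule LeastI) (rule n)
  have "m \<noteq> 0"
    using m assms(2) by (cases m) auto
  then obtain k where k: "m = Suc k"
    by (cases m) auto
  have "\<not> mesh k < x"
    using not_less_Least[of k "\<lambda>n. mesh n < x"] k m_def by simp
  moreover have "mesh k < of_int B * x"
    using m base_ge_2 by (simp add: k mesh_Suc pos_divide_less_eq mult.commute)
  ultimately show ?thesis
    using that[of k] by linarith
qed

lemma mesh_between_scales:
  assumes "0 < x" "of_int B ^ 2 * x < y" "y \<le> 1"
  obtains k n where "mesh k \<le> y" "x \<le> mesh (k + n)"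
    "(1 / of_int B) ^ n \<le> of_int B ^ 2 * (x / y)"
proof -
  have B: "1 < real_of_int B" "1 \<le> real_of_int B ^ 2"
    using base_ge_2 by auto
  have "1 * x \<le> of_int B ^ 2 * x"
    using B assms(1) by (intro mult_right_mono) auto
  then have "0 < y" and "x \<le> 1"
    using assms by linarith+
  obtain k where k: "y \<le> mesh k" "mesh k < of_int B * y"
    using mesh_between \<open>0 < y\<close> assms(3) by blast
  then have Suc_k: "mesh (Suc k) < y" "y / of_int B \<le> mesh (Suc k)"
    using B by (auto simp: mesh_Suc divide_right_mono pos_divide_less_eq mult.commute)
  obtain m where m: "x \<le> mesh m" "mesh m < of_int B * x"
    using mesh_between assms(1) \<open>x \<le> 1\<close> by blast
  have "of_int B * x < y / of_int B"
    using assms(2) B by (simp add: pos_less_divide_eq power2_eq_square mult_ac)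
  then have "mesh m < mesh (Suc k)"
    using m Suc_k by linarith
  then have "Suc k \<le> m"
    using mesh_antimono[of m "Suc k"] by linarith
  then obtain n where n: "m = Suc k + n"
    using le_Suc_ex by blast
  have "(1 / of_int B) ^ n = mesh m / mesh (Suc k)"
    using mesh_pos[of "Suc k"] unfolding n mesh_add by simp
  also have "\<dots> \<le> (of_int B * x) / (y / of_int B)"
    using m Suc_k mesh_pos[of m] \<open>0 < y\<close> B by (intro frac_le) auto
  finally have "(1 / of_int B) ^ n \<le> of_int B ^ 2 * (x / y)"
    by (simp add: power2_eq_square mult_ac)
  then show ?thesis
    using that[of "Suc k" n] Suc_k m unfolding n by simp
qed

lemma grid_point_add: "grid_point k (i + j) = grid_point k i + of_int j * mesh k"
  by (simp add: grid_point_def algebra_simps)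

lemma grid_point_diff: "grid_point k (i - j) = grid_point k i - of_int j * mesh k"
  by (simp add: grid_point_def algebra_simps)

lemma cell_index_bounds:
  "grid_point k (cell_index k x) \<le> x" "x < grid_point k (cell_index k x) + mesh k"
proof -
  have "of_int \<lfloor>x / mesh k\<rfloor> \<le> x / mesh k" "x / mesh k < of_int \<lfloor>x / mesh k\<rfloor> + 1"
    by linarith+
  then have "of_int \<lfloor>x / mesh k\<rfloor> * mesh k \<le> x" "x < (of_int \<lfloor>x / mesh k\<rfloor> + 1) * mesh k"
    using mesh_pos[of k] by (simp_all only: pos_le_divide_eq pos_divide_less_eq)
  then show "grid_point k (cell_index k x) \<le> x" "x < grid_point k (cell_index k x) + mesh k"
    by (simp_all add: grid_point_def cell_index_def distrib_right)
qed

lemma cell_index_mono: "x \<le> y \<Longrightarrow> cell_index k x \<le> cell_index k y"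
  using mesh_pos[of k] by (auto simp: cell_index_def intro!: floor_mono divide_right_mono)

lemma cell_index_grid_point: "cell_index (k + n) (grid_point k j) = B ^ n * j"
proof -
  have "grid_point k j / mesh (k + n) = of_int (B ^ n * j)"
    using mesh_pos[of k] base_ge_2 by (simp add: grid_point_def mesh_add power_divide)
  then show ?thesis
    unfolding cell_index_def by (metis floor_of_int)
qed

lemma cell_index_Suc_div: "cell_index (Suc k) x div B = cell_index k x"
  using floor_divide_real_eq_div[of B "x / mesh (Suc k)"] base_ge_2
  by (simp add: cell_index_def mesh_Suc)

lemma children_iff: "j \<in> children g \<longleftrightarrow> j div B = g"
proof
  assume "j \<in> children g"
  then show "j div B = g"
    using int_div_pos_eq[of j B g "j - B * g"] by (simp add: children_def algebra_simps)
next
  assume "j div B = g"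
  then have "j = B * g + j mod B" by auto
  moreover have "0 \<le> j mod B" "j mod B < B"
    using base_ge_2 by simp_all
  ultimately show "j \<in> children g"
    unfolding children_def atLeastLessThan_iff distrib_left by linarith
qed

lemma finite_children: "finite (children g)"
  by (simp add: children_def)

lemma card_children: "real (card (children g)) = of_int B"
  using base_ge_2 by (simp add: children_def algebra_simps)

lemma parent_Suc_cases:
  obtains (siblings) "(j + 1) div B = j div B"
  | (boundary) "j + 1 = B * (j div B + 1)" "(j + 1) div B = j div B + 1"
proof (cases "(j + 1) div B = j div B")
  case False
  have "j \<in> children (j div B)"
    by (simp add: children_iff)
  moreover have "j + 1 \<notin> children (j div B)"
    using False by (simp add: children_iff)
  ultimately have j: "j + 1 = B * (j div B + 1)"
    by (auto simp: children_def)
  have "(j + 1) div B = j div B + 1"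
    unfolding j using base_ge_2 by (intro nonzero_mult_div_cancel_left) simp
  with j show ?thesis
    by (rule boundary)
qed (rule siblings)

end

section \<open>Doubling cascades\<close>

text \<open>\<open>s k\<close> prescribes which share of the mass of its parent a cell of level \<open>k + 1\<close> receives.\<close>
locale doubling_cascade = adic_grid +
  fixes s :: "nat \<Rightarrow> int \<Rightarrow> real" and \<epsilon> :: real
  assumes eps_pos: "0 < \<epsilon>"
    and share_lower: "\<And>k j. \<epsilon> \<le> s k j"
    and share_sum: "\<And>k g. sum (s k) (children g) = 1"
    and share_matching: "\<And>k g. s k (B * g - 1) = s k (B * g)"
begin

primrec cell_mass :: "nat \<Rightarrow> int \<Rightarrow> real" where
  "cell_mass 0 j = 1"
| "cell_mass (Suc k) j = cell_mass k (j div B) * s k j"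

lemma share_pos: "0 < s k j"
  using share_lower[of k j] eps_pos by linarith

lemma share_upper: "s k j \<le> 1 - \<epsilon>"
proof -
  define g where "g = j div B"
  have j: "j \<in> children g"
    by (simp add: children_iff g_def)
  have "card (children g) \<noteq> 1"
    using card_children[of g] base_ge_2 by auto
  then have "children g \<noteq> {j}"
    by auto
  with j obtain i where i: "i \<in> children g - {j}"
    by blast
  have "s k j + \<epsilon> \<le> s k j + s k i"
    using share_lower by simp
  also have "s k i \<le> sum (s k) (children g - {j})"
    using i by (intro member_le_sum) (auto simp: finite_children less_imp_le[OF share_pos])
  also have "s k j + sum (s k) (children g - {j}) = 1"
    using sum.remove[OF finite_children j, of "s k"] by (simp add: share_sum)
  finally show ?thesis by simp
qed

lemma eps_less_1: "\<epsilon> < 1"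
  using share_upper[of 0 0] share_pos[of 0 0] by linarith

lemma cell_mass_pos: "0 < cell_mass k j"
  by (induction k arbitrary: j) (auto intro: mult_pos_pos share_pos)

lemma cell_mass_le_power: "cell_mass k j \<le> (1 - \<epsilon>) ^ k"
proof (induction k arbitrary: j)
  case (Suc k)
  have "cell_mass k (j div B) * s k j \<le> (1 - \<epsilon>) ^ k * (1 - \<epsilon>)"
    using Suc share_upper share_pos[of k j] eps_less_1 by (intro mult_mono) auto
  then show ?case by (simp add: mult.commute)
qed simp

lemma sum_cell_mass_children: "sum (cell_mass (Suc k)) (children g) = cell_mass k g"
proof -
  have "sum (cell_mass (Suc k)) (children g) = (\<Sum>j\<in>children g. cell_mass k g * s k j)"
    by (intro sum.cong) (auto simp: children_iff)
  then show ?thesis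
    by (simp add: sum_distrib_left[symmetric] share_sum)
qed

subsection \<open>Comparability of neighbouring cells\<close>

definition ratio :: real where
  "ratio = 1 / \<epsilon>"

lemma ratio_ge_1: "1 \<le> ratio"
  using eps_pos eps_less_1 by (simp add: ratio_def)

lemma share_ratio: "s k i \<le> ratio * s k j"
proof -
  have "s k i \<le> ratio * \<epsilon>"
    using share_upper[of k i] eps_pos by (simp add: ratio_def)
  also have "\<dots> \<le> ratio * s k j"
    using share_lower ratio_ge_1 by (intro mult_left_mono) auto
  finally show ?thesis .
qed

text \<open>Neighbours with different parents receive equal shares, so the ratio of two neighbouring
  masses is the one created where their ancestors first became siblings.\<close>
lemma cell_mass_neighbours:
  "cell_mass k (j + 1) \<le> ratio * cell_mass k j \<and> cell_mass k j \<le> ratio * cell_mass k (j + 1)"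
proof (induction k arbitrary: j)
  case 0
  then show ?case using ratio_ge_1 by simp
next
  case (Suc k)
  show ?case
  proof (cases j rule: parent_Suc_cases)
    case siblings
    have "cell_mass k g * s k i \<le> ratio * (cell_mass k g * s k l)" for g i l
      using mult_left_mono[OF share_ratio[of k i l], of "cell_mass k g"] cell_mass_pos[of k g]
      by (simp add: mult_ac)
    then show ?thesis using siblings by (simp only: cell_mass.simps)
  next
    case boundary
    have "s k (j + 1) = s k j"
      using share_matching[of k "j div B + 1"] unfolding boundary(1)[symmetric] by simp
    moreover have "x * s k j \<le> ratio * (y * s k j)" if "x \<le> ratio * y" for x y
      using mult_right_mono[OF that, of "s k j"] share_pos[of k j] by (simp add: mult.assoc)
    ultimately show ?thesis
      using Suc[of "j div B"] boundary(2) by simp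
  qed
qed

lemma cell_mass_shift:
  "cell_mass k (j + int n) \<le> ratio ^ n * cell_mass k j"
  "cell_mass k (j - int n) \<le> ratio ^ n * cell_mass k j"
proof (induction n)
  case (Suc n)
  have up: "cell_mass k (j + int (Suc n)) \<le> ratio * cell_mass k (j + int n)"
    using cell_mass_neighbours[of k "j + int n"] by (simp add: algebra_simps)
  have down: "cell_mass k (j - int (Suc n)) \<le> ratio * cell_mass k (j - int n)"
    using cell_mass_neighbours[of k "j - int (Suc n)"] by (simp add: algebra_simps)
  have "ratio * cell_mass k (j + int n) \<le> ratio * (ratio ^ n * cell_mass k j)"
    "ratio * cell_mass k (j - int n) \<le> ratio * (ratio ^ n * cell_mass k j)"
    using Suc ratio_ge_1 by (auto intro!: mult_left_mono)
  with up down show "cell_mass k (j + int (Suc n)) \<le> ratio ^ Suc n * cell_mass k j"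
    "cell_mass k (j - int (Suc n)) \<le> ratio ^ Suc n * cell_mass k j"
    by (simp_all add: mult.assoc)
qed simp_all

subsection \<open>The distribution function\<close>

primrec grid_value :: "nat \<Rightarrow> int \<Rightarrow> real" where
  "grid_value 0 j = of_int j"
| "grid_value (Suc k) j =
     grid_value k (j div B) + (\<Sum>i\<in>{B * (j div B)..<j}. cell_mass (Suc k) i)"

lemma grid_value_refine_Suc: "grid_value (Suc k) (B * j) = grid_value k j"
  using base_ge_2 by simp

lemma grid_value_step: "grid_value k (j + 1) = grid_value k j + cell_mass k j"
proof (induction k arbitrary: j)
  case (Suc k)
  have "j \<in> children (j div B)"
    by (simp add: children_iff)
  then have "{B * (j div B)..<j + 1} = insert j {B * (j div B)..<j}"
    by (auto simp: children_def)
  then have sum: "(\<Sum>i\<in>{B * (j div B)..<j + 1}. cell_mass (Suc k) i)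
      = (\<Sum>i\<in>{B * (j div B)..<j}. cell_mass (Suc k) i) + cell_mass (Suc k) j"
    by (simp add: add.commute)
  show ?case
  proof (cases j rule: parent_Suc_cases)
    case siblings
    then show ?thesis using sum by simp
  next
    case boundary
    have "grid_value (Suc k) j + cell_mass (Suc k) j
        = grid_value k (j div B) + (\<Sum>i\<in>{B * (j div B)..<j + 1}. cell_mass (Suc k) i)"
      using sum by simp
    also have "\<dots> = grid_value k (j div B) + sum (cell_mass (Suc k)) (children (j div B))"
      unfolding children_def boundary(1) ..
    also have "\<dots> = grid_value k (j div B + 1)"
      unfolding sum_cell_mass_children by (rule Suc[symmetric])
    also have "\<dots> = grid_value (Suc k) (j + 1)"
      unfolding boundary(1) by (rule grid_value_refine_Suc[symmetric])
    finally show ?thesis by simp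
  qed
qed simp

lemma grid_value_mono: "i \<le> j \<Longrightarrow> grid_value k i \<le> grid_value k j"
proof (induction j rule: int_ge_induct)
  case (step j)
  then show ?case using grid_value_step[of k j] cell_mass_pos[of k j] by simp
qed simp

lemma grid_value_refine: "grid_value (k + n) (B ^ n * j) = grid_value k j"
proof (induction n)
  case (Suc n)
  have "grid_value (k + Suc n) (B ^ Suc n * j) = grid_value (Suc (k + n)) (B * (B ^ n * j))"
    by (simp add: mult.assoc)
  also have "\<dots> = grid_value k j"
    using grid_value_refine_Suc Suc by simp
  finally show ?case .
qed simp

definition cdf :: "real \<Rightarrow> real" where
  "cdf x = lim (\<lambda>k. grid_value k (cell_index k x))"

lemma grid_value_tendsto_cdf: "(\<lambda>k. grid_value k (cell_index k x)) \<longlonglongrightarrow> cdf x"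
proof -
  have index: "cell_index (Suc k) x \<in> children (cell_index k x)" for k
    by (simp add: children_iff cell_index_Suc_div)
  have "grid_value k (cell_index k x) \<le> grid_value (Suc k) (cell_index (Suc k) x)" for k
    using index[of k] grid_value_mono[of "B * cell_index k x" "cell_index (Suc k) x" "Suc k"]
    unfolding grid_value_refine_Suc by (simp add: children_def)
  then have inc: "incseq (\<lambda>k. grid_value k (cell_index k x))"
    by (rule incseq_SucI)
  have upper: "grid_value k (cell_index k x + 1) \<le> grid_value 0 (cell_index 0 x + 1)" for k
  proof (induction k)
    case (Suc k)
    have "grid_value (Suc k) (cell_index (Suc k) x + 1)
        \<le> grid_value (Suc k) (B * (cell_index k x + 1))"
      using index[of k] by (intro grid_value_mono) (simp add: children_def)
    with Suc show ?case
      unfolding grid_value_refine_Suc by linarith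
  qed (rule order_refl)
  have "grid_value k (cell_index k x) \<le> grid_value 0 (cell_index 0 x + 1)" for k
    using grid_value_mono[of "cell_index k x" "cell_index k x + 1" k] upper[of k] by linarith
  then obtain u where "(\<lambda>k. grid_value k (cell_index k x)) \<longlonglongrightarrow> u"
    using incseq_convergent[OF inc] by blast
  then have "convergent (\<lambda>k. grid_value k (cell_index k x))"
    by (rule convergentI)
  then show ?thesis
    by (simp add: cdf_def convergent_LIMSEQ_iff)
qed

lemma cdf_mono: "x \<le> y \<Longrightarrow> cdf x \<le> cdf y"
  by (rule LIMSEQ_le[OF grid_value_tendsto_cdf grid_value_tendsto_cdf])
    (auto intro: grid_value_mono cell_index_mono)

lemma cdf_grid_point: "cdf (grid_point k j) = grid_value k j"
proof (rule LIMSEQ_unique[OF grid_value_tendsto_cdf])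
  have "grid_value (n + k) (cell_index (n + k) (grid_point k j)) = grid_value k j" for n
    unfolding add.commute[of n k] cell_index_grid_point by (rule grid_value_refine)
  then show "(\<lambda>n. grid_value n (cell_index n (grid_point k j))) \<longlonglongrightarrow> grid_value k j"
    by - (rule LIMSEQ_offset[where k = k], simp only: tendsto_const)
qed

lemma cdf_near_id: "\<bar>cdf x - x\<bar> \<le> 1"
proof -
  have cdf_int: "cdf (of_int j) = of_int j" for j
    using cdf_grid_point[of 0 j] by (simp add: grid_point_def)
  have "of_int \<lfloor>x\<rfloor> \<le> cdf x"
    using cdf_mono[of "of_int \<lfloor>x\<rfloor>" x] cdf_int by simp
  moreover have "cdf x \<le> of_int (\<lfloor>x\<rfloor> + 1)"
    using cdf_mono[of x "of_int (\<lfloor>x\<rfloor> + 1)"] unfolding cdf_int by simp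
  ultimately show ?thesis by linarith
qed

lemma grid_value_block:
  "grid_value k (j + int n) - grid_value k (j - int n) \<le> 2 * real n * ratio ^ n * cell_mass k j"
proof (induction n)
  case (Suc n)
  have power: "ratio ^ n \<le> ratio ^ Suc n"
    using ratio_ge_1 by (intro power_increasing) auto
  have "grid_value k (j + int (Suc n)) - grid_value k (j - int (Suc n))
      = grid_value k (j + int n) - grid_value k (j - int n)
        + cell_mass k (j + int n) + cell_mass k (j - int (Suc n))"
    using grid_value_step[of k "j + int n"] grid_value_step[of k "j - int (Suc n)"]
    by (simp add: algebra_simps)
  also have "\<dots> \<le> 2 * real n * ratio ^ n * cell_mass k j + ratio ^ n * cell_mass k j
      + ratio ^ Suc n * cell_mass k j"
    using Suc cell_mass_shift(1)[of k j n] cell_mass_shift(2)[of k j "Suc n"] by linarith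
  also have "\<dots> \<le> 2 * real n * ratio ^ Suc n * cell_mass k j + ratio ^ Suc n * cell_mass k j
      + ratio ^ Suc n * cell_mass k j"
    using power cell_mass_pos[of k j] by (intro add_mono mult_right_mono mult_left_mono) auto
  also have "\<dots> = 2 * real (Suc n) * ratio ^ Suc n * cell_mass k j"
    by (simp add: algebra_simps)
  finally show ?case .
qed simp

lemma cdf_ball_lower:
  assumes "mesh k \<le> r"
  shows "cell_mass k (cell_index k x) \<le> cdf (x + r) - cdf (x - r)"
proof -
  define j where "j = cell_index k x"
  have "x - r \<le> grid_point k j" "grid_point k (j + 1) \<le> x + r"
    using cell_index_bounds[where k = k and x = x] assms by (simp_all add: j_def grid_point_add)
  then have "cdf (x - r) \<le> grid_value k j" "grid_value k (j + 1) \<le> cdf (x + r)"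
    unfolding cdf_grid_point[symmetric] by (simp_all add: cdf_mono)
  then show ?thesis
    using grid_value_step[of k j] unfolding j_def by linarith
qed

lemma cdf_ball_upper:
  assumes "r \<le> real n * mesh k"
  shows "cdf (x + r) - cdf (x - r)
    \<le> 2 * real (Suc n) * ratio ^ Suc n * cell_mass k (cell_index k x)"
proof -
  define j where "j = cell_index k x"
  have "grid_point k (j - int (Suc n)) \<le> x - r" "x + r \<le> grid_point k (j + int (Suc n))"
    unfolding grid_point_add grid_point_diff
    using cell_index_bounds[where k = k and x = x] assms by (simp_all add: j_def distrib_right)
  then have "grid_value k (j - int (Suc n)) \<le> cdf (x - r)"
    "cdf (x + r) \<le> grid_value k (j + int (Suc n))"
    unfolding cdf_grid_point[symmetric] by (simp_all add: cdf_mono)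
  then show ?thesis
    using grid_value_block[of k j "Suc n"] unfolding j_def by linarith
qed

lemma strict_mono_cdf: "strict_mono cdf"
proof (rule strict_monoI)
  fix x y :: real
  assume "x < y"
  then obtain k where k: "mesh k \<le> (y - x) / 2"
    using real_arch_pow_inv[of "(y - x) / 2" "1 / of_int B"] base_ge_2
    by (auto simp: mesh_def power_divide intro: less_imp_le)
  have "x = (x + y) / 2 - (y - x) / 2" "y = (x + y) / 2 + (y - x) / 2"
    by (simp_all add: field_simps)
  then show "cdf x < cdf y"
    using cdf_ball_lower[OF k, of "(x + y) / 2"] cell_mass_pos[of k "cell_index k ((x + y) / 2)"]
    by simp
qed

lemma continuous_on_cdf: "continuous_on UNIV cdf"
proof (rule continuous_at_imp_continuous_on, rule ballI)
  fix x
  show "isCont cdf x"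
    unfolding continuous_at_eps_delta
  proof (intro allI impI)
    fix e :: real
    assume "0 < e"
    then obtain k where "(1 - \<epsilon>) ^ k < e / (4 * ratio ^ 2)"
      using real_arch_pow_inv[of "e / (4 * ratio ^ 2)" "1 - \<epsilon>"] ratio_ge_1 eps_pos by auto
    then have "4 * ratio ^ 2 * (1 - \<epsilon>) ^ k < e"
      using ratio_ge_1 by (simp add: pos_less_divide_eq mult_ac)
    moreover have "cdf (x + mesh k) - cdf (x - mesh k)
        \<le> 4 * ratio ^ 2 * cell_mass k (cell_index k x)"
      using cdf_ball_upper[of "mesh k" 1 k x] by (simp add: numeral_2_eq_2)
    moreover have "4 * ratio ^ 2 * cell_mass k (cell_index k x) \<le> 4 * ratio ^ 2 * (1 - \<epsilon>) ^ k"
      by (intro mult_left_mono cell_mass_le_power) simp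
    ultimately have small: "cdf (x + mesh k) - cdf (x - mesh k) < e"
      by linarith
    have "\<bar>cdf y - cdf x\<bar> < e" if "\<bar>y - x\<bar> < mesh k" for y
    proof -
      have "cdf (x - mesh k) \<le> cdf y" "cdf y \<le> cdf (x + mesh k)"
        "cdf (x - mesh k) \<le> cdf x" "cdf x \<le> cdf (x + mesh k)"
        using that mesh_pos[of k] by (auto intro!: cdf_mono)
      then show ?thesis using small by linarith
    qed
    then show "\<exists>\<delta>>0. \<forall>y. dist y x < \<delta> \<longrightarrow> dist (cdf y) (cdf x) < e"
      using mesh_pos[of k] by (auto simp: dist_real_def)
  qed
qed

subsection \<open>The cascade measure\<close>

definition doubling_factor :: real where
  "doubling_factor = 2 * of_int (4 * B + 1) * ratio ^ nat (4 * B + 1)"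

lemma doubling_factor_ge_10: "10 \<le> doubling_factor"
proof -
  have "10 * 1 \<le> 2 * of_int (4 * B + 1) * ratio ^ nat (4 * B + 1)"
    using base_ge_2 ratio_ge_1 by (intro mult_mono one_le_power) auto
  then show ?thesis by (simp add: doubling_factor_def)
qed

lemma cdf_doubling:
  assumes "0 < r"
  shows "cdf (x + 2 * r) - cdf (x - 2 * r) \<le> doubling_factor * (cdf (x + r) - cdf (x - r))"
proof (cases "r \<le> 2")
  case True
  then obtain k where k: "r / 2 \<le> mesh k" "mesh k < of_int B * (r / 2)"
    using mesh_between[of "r / 2"] assms by auto
  have "2 * r \<le> real (nat (4 * B)) * mesh (Suc k)"
    using k(1) base_ge_2 by (simp add: mesh_Suc)
  moreover have "mesh (Suc k) \<le> r"
    using k(2) mesh_pos[of k] base_ge_2 by (simp add: mesh_Suc pos_divide_le_eq mult.commute)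
  moreover have "Suc (nat (4 * B)) = nat (4 * B + 1)" "real (nat (4 * B + 1)) = of_int (4 * B + 1)"
    using base_ge_2 by auto
  ultimately have "cdf (x + 2 * r) - cdf (x - 2 * r)
      \<le> doubling_factor * cell_mass (Suc k) (cell_index (Suc k) x)"
    "cell_mass (Suc k) (cell_index (Suc k) x) \<le> cdf (x + r) - cdf (x - r)"
    using cdf_ball_upper[of "2 * r" "nat (4 * B)" "Suc k" x] cdf_ball_lower[of "Suc k" r x]
    by (simp_all only: doubling_factor_def)
  then show ?thesis
    using doubling_factor_ge_10 by (meson mult_left_mono order_trans zero_le_numeral)
next
  case False
  have "cdf (x + 2 * r) - cdf (x - 2 * r) \<le> 4 * r + 2" "2 * r - 2 \<le> cdf (x + r) - cdf (x - r)"
    using cdf_near_id[of "x + 2 * r"] cdf_near_id[of "x - 2 * r"]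
      cdf_near_id[of "x + r"] cdf_near_id[of "x - r"] by linarith+
  then have "cdf (x + 2 * r) - cdf (x - 2 * r) \<le> 10 * (cdf (x + r) - cdf (x - r))"
    using False by argo
  also have "\<dots> \<le> doubling_factor * (cdf (x + r) - cdf (x - r))"
    using assms by (intro mult_right_mono doubling_factor_ge_10) (simp add: cdf_mono)
  finally show ?thesis .
qed

definition cascade_measure :: "real measure" where
  "cascade_measure = interval_measure cdf"

lemma emeasure_cascade_measure_Ioo:
  "x \<le> y \<Longrightarrow> emeasure cascade_measure {x<..<y} = ennreal (cdf y - cdf x)"
  unfolding cascade_measure_def
  by (intro emeasure_interval_measure_Ioo cdf_mono continuous_on_cdf)

lemma doubling_cascade_measure: "doubling_measure cascade_measure"
  unfolding cascade_measure_def
  by (rule doubling_interval_measure[OF strict_mono_cdf continuous_on_cdf cdf_doubling])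

end

section \<open>Cascades that are thin near separated points\<close>

context adic_grid
begin

text \<open>A cell is completed by its neighbour across the boundary of its parent, so that the shares on
  both sides of such a boundary can be made equal.\<close>
definition twin_cells :: "int \<Rightarrow> int set" where
  "twin_cells i = {j. j = i \<or> j = i - 1 \<and> B dvd i \<or> j = i + 1 \<and> B dvd j}"

lemma twin_cells_self: "i \<in> twin_cells i"
  by (simp add: twin_cells_def)

lemma twin_cells_near: "j \<in> twin_cells i \<Longrightarrow> \<bar>j - i\<bar> \<le> 1"
  by (auto simp: twin_cells_def)

lemma not_base_dvd:
  assumes "0 < \<bar>n\<bar>" "\<bar>n\<bar> < B"
  shows "\<not> B dvd B * g + n"
proof
  assume "B dvd B * g + n"
  then have "B dvd n"
    by (simp add: dvd_add_right_iff)
  then show False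
    using dvd_imp_le_int[of n B] assms by simp
qed

lemma twin_cells_boundary: "B * g - 1 \<in> twin_cells i \<longleftrightarrow> B * g \<in> twin_cells i"
  using not_base_dvd[of 1 g] not_base_dvd[of "- 1" g] base_ge_2 by (auto simp: twin_cells_def)

lemma twin_cells_siblings_eq:
  assumes "i \<in> twin_cells r" "j \<in> twin_cells r" and siblings: "i div B = j div B"
  shows "i = j"
proof -
  have boundary: "x div B \<noteq> (x + 1) div B" if dvd: "B dvd x + 1" for x
  proof
    obtain h where h: "x + 1 = B * h"
      using dvd by blast
    assume "x div B = (x + 1) div B"
    then have "x \<in> children h"
      using base_ge_2 by (simp add: children_iff h)
    then show False
      using h by (simp add: children_def)
  qed
  have "\<not> (B dvd r \<and> B dvd r + 1)"
    using not_base_dvd[of 1 "r div B"] base_ge_2 by auto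
  then show ?thesis
    using assms(1,2) boundary[of r] boundary[of "r - 1"] siblings by (auto simp: twin_cells_def)
qed

end

lemma min_one_power_le_powr:
  fixes x K p :: real
  assumes "0 < x" "1 \<le> K" "0 \<le> p" "p \<le> real q"
  shows "min 1 ((K * x) ^ q) \<le> K ^ q * x powr p"
proof (cases "x \<le> 1")
  case True
  then have "x ^ q \<le> x powr p"
    using assms by (simp add: powr_realpow[symmetric] powr_mono')
  then have "(K * x) ^ q \<le> K ^ q * x powr p"
    using assms(2) by (simp add: power_mult_distrib mult_left_mono)
  then show ?thesis by simp
next
  case False
  then have "1 * 1 \<le> K ^ q * x powr p"
    using assms by (intro mult_mono one_le_power ge_one_powr_ge_zero) auto
  then show ?thesis by simp
qed

locale separated_points = adic_grid +
  fixes T :: "'i set" and z L l :: "'i \<Rightarrow> real" and q :: nat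
  assumes base_ge_4: "4 \<le> B"
    and separated: "pairwise (\<lambda>i j. 2 * min (L i) (L j) \<le> \<bar>z i - z j\<bar>) T"
    and exponent_pos: "1 \<le> q"
begin

definition \<epsilon> :: real where
  "\<epsilon> = (1 / of_int B) ^ q"

definition reduced :: "nat \<Rightarrow> int \<Rightarrow> bool" where
  "reduced k j \<longleftrightarrow>
    (\<exists>i\<in>T. l i \<le> mesh k \<and> mesh k \<le> L i \<and> j \<in> twin_cells (cell_index (Suc k) (z i)))"

text \<open>The mass taken from a reduced cell goes to an inner sibling, since outer children have to
  match their neighbours.\<close>
definition compensator :: "int \<Rightarrow> int" where
  "compensator j = B * (j div B) + (if j = B * (j div B) + 1 then 2 else 1)"

definition share :: "nat \<Rightarrow> int \<Rightarrow> real" where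
  "share k j =
    (if reduced k j then \<epsilon>
     else if \<exists>i. reduced k i \<and> compensator i = j then 2 / of_int B - \<epsilon>
     else 1 / of_int B)"

lemma reduced_siblings_eq:
  assumes j: "reduced k j" and j': "reduced k j'" and parent: "j div B = j' div B"
  shows "j = j'"
proof -
  obtain i where i: "i \<in> T" "mesh k \<le> L i" "j \<in> twin_cells (cell_index (Suc k) (z i))"
    using j unfolding reduced_def by auto
  obtain i' where i': "i' \<in> T" "mesh k \<le> L i'" "j' \<in> twin_cells (cell_index (Suc k) (z i'))"
    using j' unfolding reduced_def by auto
  have "j \<in> children (j' div B)" "j' \<in> children (j' div B)"
    using parent by (simp_all add: children_iff)
  then have "\<bar>j - j'\<bar> \<le> B - 1"
    by (auto simp: children_def distrib_left)
  then have "\<bar>cell_index (Suc k) (z i) - cell_index (Suc k) (z i')\<bar> \<le> B + 1"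
    using twin_cells_near[OF i(3)] twin_cells_near[OF i'(3)] by linarith
  then have "\<bar>z i / mesh (Suc k) - z i' / mesh (Suc k)\<bar> < of_int B + 2"
    unfolding cell_index_def by linarith
  also have "\<dots> \<le> 2 * of_int B"
    using base_ge_4 by simp
  finally have "\<bar>z i - z i'\<bar> / mesh (Suc k) < 2 * of_int B"
    using mesh_pos[of "Suc k"] by (simp add: diff_divide_distrib[symmetric] abs_divide)
  then have "\<bar>z i - z i'\<bar> < 2 * mesh k"
    using mesh_pos[of k] base_ge_4 by (simp add: mesh_Suc field_simps)
  then have "i = i'"
    using pairwiseD[OF separated i(1) i'(1)] i(2) i'(2) by fastforce
  then show ?thesis
    using twin_cells_siblings_eq[OF i(3) _ parent] i'(3) by simp
qed

lemma compensator_div: "compensator j div B = j div B"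
  using base_ge_4 by (simp add: compensator_def)

lemma compensator_neq: "compensator j \<noteq> j"
  by (simp add: compensator_def)

lemma compensator_inner: "compensator j \<noteq> B * g" "compensator j \<noteq> B * g - 1"
proof -
  have "\<not> B dvd compensator j" "\<not> B dvd compensator j + 1"
    using not_base_dvd[of _ "j div B"] base_ge_4 by (auto simp: compensator_def add.assoc)
  then show "compensator j \<noteq> B * g" "compensator j \<noteq> B * g - 1"
    by auto
qed

lemma eps_bounds: "0 < \<epsilon>" "\<epsilon> \<le> 1 / of_int B"
  using power_decreasing[of 1 q "1 / real_of_int B"] exponent_pos base_ge_4
  by (simp_all add: \<epsilon>_def)

lemma share_boundary: "share k (B * g - 1) = share k (B * g)"
proof -
  have "reduced k (B * g - 1) \<longleftrightarrow> reduced k (B * g)"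
    unfolding reduced_def twin_cells_boundary ..
  then show ?thesis
    by (simp add: share_def compensator_inner)
qed

lemma share_reduced_family:
  assumes r: "r \<in> children g" "reduced k r" and j: "j \<in> children g"
  shows "share k j = 1 / of_int B + ((if j = r then \<epsilon> - 1 / of_int B else 0)
    + (if j = compensator r then 1 / of_int B - \<epsilon> else 0))"
proof -
  have siblings: "j div B = r div B"
    using r(1) j by (simp add: children_iff)
  then have "reduced k j \<longleftrightarrow> j = r"
    using reduced_siblings_eq[OF _ r(2)] r(2) by blast
  moreover have "i = r" if "reduced k i" "compensator i = j" for i
    using reduced_siblings_eq[OF that(1) r(2)] siblings compensator_div[of i]
    unfolding that(2) by (simp only:)
  then have "(\<exists>i. reduced k i \<and> compensator i = j) \<longleftrightarrow> j = compensator r"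
    using r(2) by blast
  ultimately show ?thesis
    using compensator_neq[of r] by (auto simp: share_def)
qed

lemma sum_share_children: "sum (share k) (children g) = 1"
proof -
  have uniform: "(\<Sum>j\<in>children g. 1 / real_of_int B) = 1"
    using base_ge_4 by (simp add: card_children)
  show ?thesis
  proof (cases "\<exists>r\<in>children g. reduced k r")
    case True
    then obtain r where r: "r \<in> children g" "reduced k r"
      by blast
    then have "compensator r \<in> children g"
      using compensator_div by (simp add: children_iff)
    have "sum (share k) (children g) = (\<Sum>j\<in>children g. 1 / of_int B
        + ((if j = r then \<epsilon> - 1 / of_int B else 0)
          + (if j = compensator r then 1 / of_int B - \<epsilon> else 0)))"
      by (rule sum.cong[OF refl share_reduced_family[OF r]])
    also have "\<dots> = 1 + ((\<epsilon> - 1 / of_int B) + (1 / of_int B - \<epsilon>))"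
      unfolding sum.distrib uniform using r \<open>compensator r \<in> children g\<close>
      by (simp add: finite_children)
    finally show ?thesis by simp
  next
    case False
    then have "share k j = 1 / of_int B" if "j \<in> children g" for j
      using that compensator_div by (auto simp: share_def children_iff)
    then have "sum (share k) (children g) = (\<Sum>j\<in>children g. 1 / of_int B)"
      by (intro sum.cong refl)
    then show ?thesis
      unfolding uniform .
  qed
qed

sublocale doubling_cascade B share \<epsilon>
proof
  show "\<epsilon> \<le> share k j" for k j
    using eps_bounds by (auto simp: share_def)
qed (fact eps_bounds sum_share_children share_boundary)+

lemma cell_mass_decay_at_point:
  assumes "i \<in> T" "mesh k \<le> L i" "l i \<le> mesh (k + n)"
  shows "cell_mass (k + n) (cell_index (k + n) (z i)) = \<epsilon> ^ n * cell_mass k (cell_index k (z i))"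
  using assms(3)
proof (induction n)
  case (Suc n)
  have "mesh (k + Suc n) \<le> mesh (k + n)" "mesh (k + n) \<le> mesh k"
    by (simp_all add: mesh_antimono)
  then have n: "l i \<le> mesh (k + n)" "mesh (k + n) \<le> L i"
    using Suc.prems assms(2) by linarith+
  then have "reduced (k + n) (cell_index (Suc (k + n)) (z i))"
    using assms(1) twin_cells_self unfolding reduced_def by blast
  then have "share (k + n) (cell_index (Suc (k + n)) (z i)) = \<epsilon>"
    by (simp add: share_def)
  then show ?case
    using Suc.IH[OF n(1)] by (simp add: cell_index_Suc_div)
qed simp

lemma cell_mass_thin:
  assumes "i \<in> T" "0 < l i" "of_int B ^ 2 * l i < L i" "L i \<le> 1"
  obtains k m where "mesh k \<le> L i" "l i \<le> mesh m"
    "cell_mass m (cell_index m (z i))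
      \<le> (of_int B ^ 2 * (l i / L i)) ^ q * cell_mass k (cell_index k (z i))"
proof -
  obtain k n where k: "mesh k \<le> L i" and n: "l i \<le> mesh (k + n)"
    and le: "(1 / of_int B) ^ n \<le> of_int B ^ 2 * (l i / L i)"
    using mesh_between_scales[OF assms(2-4)] by blast
  have "((1 / of_int B) ^ n) ^ q \<le> (of_int B ^ 2 * (l i / L i)) ^ q"
    using base_ge_4 by (intro power_mono le) simp
  then have "\<epsilon> ^ n \<le> (of_int B ^ 2 * (l i / L i)) ^ q"
    by (simp only: \<epsilon>_def power_mult[symmetric] mult.commute)
  then have "\<epsilon> ^ n * cell_mass k (cell_index k (z i))
      \<le> (of_int B ^ 2 * (l i / L i)) ^ q * cell_mass k (cell_index k (z i))"
    by (intro mult_right_mono less_imp_le[OF cell_mass_pos])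
  then show ?thesis
    using that[OF k n] cell_mass_decay_at_point[OF assms(1) k n] by simp
qed

lemma cdf_thin:
  assumes "i \<in> T" "0 < l i" "of_int B ^ 2 * l i < L i" "L i \<le> 1"
  shows "cdf (z i + l i) - cdf (z i - l i)
    \<le> 4 * ratio ^ 2 * (of_int B ^ 2 * (l i / L i)) ^ q * (cdf (z i + L i) - cdf (z i - L i))"
proof -
  obtain k m where k: "mesh k \<le> L i" and m: "l i \<le> mesh m"
    and thin: "cell_mass m (cell_index m (z i))
      \<le> (of_int B ^ 2 * (l i / L i)) ^ q * cell_mass k (cell_index k (z i))"
    using cell_mass_thin[OF assms] by blast
  have "0 < L i"
    using k mesh_pos[of k] by linarith
  have "cdf (z i + l i) - cdf (z i - l i) \<le> 4 * ratio ^ 2 * cell_mass m (cell_index m (z i))"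
    using cdf_ball_upper[of "l i" 1 m "z i"] m by (simp add: numeral_2_eq_2)
  also have "\<dots> \<le> 4 * ratio ^ 2
      * ((of_int B ^ 2 * (l i / L i)) ^ q * cell_mass k (cell_index k (z i)))"
    by (intro mult_left_mono thin) simp
  also have "\<dots> \<le> 4 * ratio ^ 2
      * ((of_int B ^ 2 * (l i / L i)) ^ q * (cdf (z i + L i) - cdf (z i - L i)))"
    using assms(2) \<open>0 < L i\<close> by (intro mult_left_mono cdf_ball_lower k) simp_all
  finally show ?thesis
    by (simp add: mult.assoc)
qed

lemma cdf_thin_interval:
  assumes "i \<in> T" "0 < l i" "0 < L i" "L i \<le> 1"
    and inner: "z i - l i \<le> c" "d \<le> z i + l i"
    and outer: "a \<le> z i - L i" "z i + L i \<le> b" "a \<le> c" "d \<le> b"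
  shows "cdf d - cdf c
    \<le> 4 * ratio ^ 2 * min 1 ((of_int B ^ 2 * (l i / L i)) ^ q) * (cdf b - cdf a)"
proof (cases "of_int B ^ 2 * l i < L i")
  case True
  let ?x = "(of_int B ^ 2 * (l i / L i)) ^ q"
  have "cdf d - cdf c \<le> cdf (z i + l i) - cdf (z i - l i)"
    using inner by (intro diff_mono cdf_mono)
  also have "\<dots> \<le> 4 * ratio ^ 2 * ?x * (cdf (z i + L i) - cdf (z i - L i))"
    by (rule cdf_thin[OF assms(1,2) True assms(4)])
  also have "\<dots> \<le> 4 * ratio ^ 2 * ?x * (cdf b - cdf a)"
    using assms(2,3) outer by (intro mult_left_mono diff_mono cdf_mono) simp_all
  also have "?x = min 1 ?x"
    using True assms(2,3) by (intro min_absorb2[symmetric] power_le_one) simp_all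
  finally show ?thesis .
next
  case False
  then have "1 \<le> (of_int B ^ 2 * (l i / L i)) ^ q"
    using assms(3) by (intro one_le_power) (simp add: pos_le_divide_eq)
  moreover have "1 \<le> ratio ^ 2"
    using ratio_ge_1 by (rule one_le_power)
  ultimately have "1 \<le> 4 * ratio ^ 2 * min 1 ((of_int B ^ 2 * (l i / L i)) ^ q)"
    by simp
  moreover have "cdf a \<le> cdf b"
    using assms(3) outer by (intro cdf_mono) linarith
  ultimately have "1 * (cdf b - cdf a)
      \<le> 4 * ratio ^ 2 * min 1 ((of_int B ^ 2 * (l i / L i)) ^ q) * (cdf b - cdf a)"
    by (intro mult_right_mono) simp_all
  moreover have "cdf d - cdf c \<le> cdf b - cdf a"
    using outer by (intro diff_mono cdf_mono)
  ultimately show ?thesis by simp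
qed

lemma emeasure_cascade_measure_thin:
  assumes i: "i \<in> T" "0 < l i" "0 < L i" "L i \<le> 1" and "0 \<le> p" "p \<le> real q"
    and inner: "z i - l i \<le> c" "c \<le> d" "d \<le> z i + l i"
    and outer: "a \<le> z i - L i" "z i + L i \<le> b" "a \<le> c" "d \<le> b"
  shows "emeasure cascade_measure {c<..<d}
    \<le> ennreal (4 * ratio ^ 2 * (of_int B ^ 2) ^ q * (l i / L i) powr p)
      * emeasure cascade_measure {a<..<b}"
proof -
  have nonneg: "0 \<le> cdf b - cdf a"
    using inner(2) outer by (simp add: cdf_mono)
  have "cdf d - cdf c
      \<le> 4 * ratio ^ 2 * min 1 ((of_int B ^ 2 * (l i / L i)) ^ q) * (cdf b - cdf a)"
    using cdf_thin_interval[OF i inner(1,3) outer] .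
  also have "\<dots> \<le> 4 * ratio ^ 2 * ((of_int B ^ 2) ^ q * (l i / L i) powr p) * (cdf b - cdf a)"
    using i assms(5,6) nonneg base_ge_4
    by (intro mult_right_mono mult_left_mono min_one_power_le_powr one_le_power) simp_all
  finally have "ennreal (cdf d - cdf c)
      \<le> ennreal (4 * ratio ^ 2 * (of_int B ^ 2) ^ q * (l i / L i) powr p * (cdf b - cdf a))"
    by (intro ennreal_leI) (simp add: mult.assoc)
  then show ?thesis
    using inner(2) outer nonneg by (simp add: emeasure_cascade_measure_Ioo ennreal_mult'')
qed

end

lemma exists_doubling_measure_thin_on_gaps:
  fixes T :: "'i set" and a b c d z L :: "'i \<Rightarrow> real" and p :: real
  assumes separated: "pairwise (\<lambda>i j. 2 * min (L i) (L j) \<le> \<bar>z i - z j\<bar>) T"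
    and scale: "\<And>i. i \<in> T \<Longrightarrow> 0 < L i" "\<And>i. i \<in> T \<Longrightarrow> L i \<le> 1"
    and gap: "\<And>i. i \<in> T \<Longrightarrow> a i \<le> c i" "\<And>i. i \<in> T \<Longrightarrow> d i \<le> b i"
    and centre: "\<And>i. i \<in> T \<Longrightarrow> z i \<in> {c i<..<d i} \<inter> {a i + L i..b i - L i}"
    and "0 < p"
  shows "\<exists>M K. doubling_measure M \<and> 0 < K \<and> (\<forall>i\<in>T. emeasure M {c i<..<d i}
    \<le> ennreal (K * ((d i - c i) / L i) powr p) * emeasure M {a i<..<b i})"
proof -
  define q where "q = max 1 (nat \<lceil>p\<rceil>)"
  have q: "1 \<le> q" "p \<le> real q"
    unfolding q_def by linarith+
  interpret separated_points 4 T z L "\<lambda>i. d i - c i" q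
    using separated q(1) by unfold_locales simp_all
  define K where "K = 4 * ratio ^ 2 * (of_int 4 ^ 2) ^ q"
  have "emeasure cascade_measure {c i<..<d i}
      \<le> ennreal (K * ((d i - c i) / L i) powr p) * emeasure cascade_measure {a i<..<b i}"
    if i: "i \<in> T" for i
  proof -
    have "c i < z i" "z i < d i" "a i + L i \<le> z i" "z i \<le> b i - L i"
      using centre[OF i] by simp_all
    then show ?thesis
      using i scale[OF i] gap[OF i] q(2) \<open>0 < p\<close> unfolding K_def
      by (intro emeasure_cascade_measure_thin) simp_all
  qed
  moreover have "0 < K"
    using ratio_ge_1 by (simp add: K_def)
  ultimately show ?thesis
    using doubling_cascade_measure by blast
qed

section \<open>Removing small portions of a set\<close>

lemma emeasure_UN_le_portion:
  assumes X: "countable X" "disjoint_family_on V X"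
    and sets: "\<And>i. i \<in> X \<Longrightarrow> W i \<in> sets M" "\<And>i. i \<in> X \<Longrightarrow> V i \<in> sets M" "E \<in> sets M"
    and subset: "\<And>i. i \<in> X \<Longrightarrow> W i \<subseteq> V i" "\<And>i. i \<in> X \<Longrightarrow> V i \<subseteq> E"
    and portion: "\<And>i. i \<in> X \<Longrightarrow> emeasure M (W i) \<le> \<beta> * emeasure M (V i)"
  shows "emeasure M (\<Union>i\<in>X. W i) \<le> \<beta> * emeasure M E"
proof -
  have disjoint: "disjoint_family_on W X"
    by (rule disjoint_family_on_bisimulation[OF X(2)]) (use subset(1) in blast)
  have "emeasure M (\<Union>i\<in>X. W i) = (\<integral>\<^sup>+i. emeasure M (W i) \<partial>count_space X)"
    by (rule emeasure_UN_countable[OF sets(1) X(1) disjoint])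
  also have "\<dots> \<le> (\<integral>\<^sup>+i. \<beta> * emeasure M (V i) \<partial>count_space X)"
    using portion by (intro nn_integral_mono) simp
  also have "\<dots> = \<beta> * (\<integral>\<^sup>+i. emeasure M (V i) \<partial>count_space X)"
    by (simp add: nn_integral_cmult)
  also have "(\<integral>\<^sup>+i. emeasure M (V i) \<partial>count_space X) = emeasure M (\<Union>i\<in>X. V i)"
    by (rule emeasure_UN_countable[OF sets(2) X, symmetric])
  also have "\<beta> * emeasure M (\<Union>i\<in>X. V i) \<le> \<beta> * emeasure M E"
    using subset(2) sets(3) by (intro mult_left_mono emeasure_mono) auto
  finally show ?thesis .
qed

lemma emeasure_Diff_UN_pos:
  fixes G :: "nat \<Rightarrow> 'a set" and \<beta> :: "nat \<Rightarrow> real"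
  assumes E: "E \<in> sets M" "0 < emeasure M E" "emeasure M E < \<infinity>"
    and G: "\<And>n. G n \<in> sets M" "\<And>n. emeasure M (G n) \<le> ennreal (\<beta> n) * emeasure M E"
    and \<beta>: "\<And>n. 0 \<le> \<beta> n" "summable \<beta>" "(\<Sum>n. \<beta> n) < 1"
  shows "0 < emeasure M (E - (\<Union>n. G n))"
proof (rule ccontr)
  assume "\<not> 0 < emeasure M (E - (\<Union>n. G n))"
  then have null: "emeasure M (E - (\<Union>n. G n)) = 0" by simp
  have UN: "(\<Union>n. G n) \<in> sets M"
    using G(1) by (intro sets.countable_UN) auto
  have "emeasure M E \<le> emeasure M ((E - (\<Union>n. G n)) \<union> (\<Union>n. G n))"
    using E(1) UN by (intro emeasure_mono) auto
  also have "\<dots> \<le> emeasure M (E - (\<Union>n. G n)) + emeasure M (\<Union>n. G n)"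
    using E(1) UN by (intro emeasure_subadditive) auto
  also have "\<dots> \<le> (\<Sum>n. emeasure M (G n))"
    unfolding null add_0 using G(1) by (intro emeasure_subadditive_countably) auto
  also have "\<dots> \<le> (\<Sum>n. ennreal (\<beta> n) * emeasure M E)"
    by (intro suminf_le G(2) summableI)
  also have "\<dots> = ennreal (\<Sum>n. \<beta> n) * emeasure M E"
    using \<beta>(1,2) by (simp add: suminf_ennreal2)
  also have "\<dots> < 1 * emeasure M E"
    using E(2,3) \<beta>(3) by (intro ennreal_mult_strict_right_mono) (auto simp: ennreal_less_one_iff)
  finally show False by simp
qed

section \<open>Cantor schemes\<close>

locale cantor_scheme =
  fixes Ix :: "nat \<Rightarrow> 'i set" and a b c d :: "nat \<Rightarrow> 'i \<Rightarrow> real"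
  assumes construction: "cantor_construction Ix a b c d"
    and gap_nonempty: "\<And>n i. 1 \<le> n \<Longrightarrow> i \<in> Ix n \<Longrightarrow> c n i < d n i"
begin

abbreviation interval :: "nat \<Rightarrow> 'i \<Rightarrow> real set" where
  "interval n i \<equiv> {a n i..b n i}"

abbreviation open_interval :: "nat \<Rightarrow> 'i \<Rightarrow> real set" where
  "open_interval n i \<equiv> {a n i<..<b n i}"

abbreviation gap :: "nat \<Rightarrow> 'i \<Rightarrow> real set" where
  "gap n i \<equiv> {c n i<..<d n i}"

abbreviation len :: "nat \<Rightarrow> 'i \<Rightarrow> real" where
  "len n i \<equiv> b n i - a n i"

abbreviation stage :: "nat \<Rightarrow> real set" where
  "stage n \<equiv> (\<Union>i\<in>Ix n. interval n i)"

lemma gap_bounds: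
  assumes "1 \<le> n" "i \<in> Ix n"
  shows "a n i \<le> c n i" "d n i \<le> b n i" "a n i < b n i"
proof -
  have "gap n i \<subseteq> interval n i"
    using construction[unfolded cantor_construction_def, THEN conjunct1] assms by blast
  then show "a n i \<le> c n i" "d n i \<le> b n i"
    using gap_nonempty[OF assms] by (auto simp: greaterThanLessThan_subseteq_atLeastAtMost_iff)
  then show "a n i < b n i"
    using gap_nonempty[OF assms] by linarith
qed

lemma gap_subset_open_interval: "1 \<le> n \<Longrightarrow> i \<in> Ix n \<Longrightarrow> gap n i \<subseteq> open_interval n i"
  using gap_bounds[of n i] by auto

lemma open_intervals_disjoint:
  "1 \<le> n \<Longrightarrow> i \<in> Ix n \<Longrightarrow> j \<in> Ix n \<Longrightarrow> i \<noteq> j \<Longrightarrow> open_interval n i \<inter> open_interval n j = {}"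
  using construction unfolding cantor_construction_def by (elim conjE) simp

lemma interval_parent:
  "1 \<le> n \<Longrightarrow> i \<in> Ix (Suc n) \<Longrightarrow> \<exists>j\<in>Ix n. interval (Suc n) i \<subseteq> interval n j"
  using construction unfolding cantor_construction_def by blast

lemma stage_Suc: "1 \<le> n \<Longrightarrow> stage (Suc n) = stage n - (\<Union>i\<in>Ix n. gap n i)"
  using construction unfolding cantor_construction_def by blast

lemma len_eventually_le:
  assumes "0 < e"
  obtains N where "\<And>n i. N \<le> n \<Longrightarrow> i \<in> Ix n \<Longrightarrow> len n i \<le> e"
  using construction assms unfolding cantor_construction_def by meson

lemma stage_antimono:
  assumes "1 \<le> n" "n \<le> m"
  shows "stage m \<subseteq> stage n"
  using assms(2)
proof (induction m rule: dec_induct)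
  case (step m)
  then show ?case using stage_Suc[of m] assms(1) by auto
qed simp

lemma interval_ancestor:
  assumes "1 \<le> n" "n \<le> m" "i \<in> Ix m"
  obtains j where "j \<in> Ix n" "interval m i \<subseteq> interval n j"
proof -
  have "\<exists>j\<in>Ix n. interval m i \<subseteq> interval n j"
    using assms(2,3)
  proof (induction m arbitrary: i rule: dec_induct)
    case (step m)
    then obtain j where "j \<in> Ix m" "interval (Suc m) i \<subseteq> interval m j"
      using interval_parent[of m i] assms(1) by auto
    with step.IH[of j] show ?case by blast
  qed blast
  then show ?thesis using that by blast
qed

lemma gap_avoids_later:
  assumes "1 \<le> n" "n < m" "i \<in> Ix n" "j \<in> Ix m"
  shows "gap n i \<inter> interval m j = {}"
proof -
  have "interval m j \<subseteq> stage m"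
    using assms(4) by blast
  also have "\<dots> \<subseteq> stage (Suc n)"
    using assms(2) by (intro stage_antimono) simp_all
  also have "\<dots> \<subseteq> - gap n i"
    using stage_Suc[OF assms(1)] assms(3) by auto
  finally show ?thesis by blast
qed

lemma open_interval_meets_interval_imp_eq:
  assumes "1 \<le> n" "i \<in> Ix n" "j \<in> Ix n" "x \<in> interval n i" "x \<in> open_interval n j"
  shows "i = j"
proof (rule ccontr)
  assume "i \<noteq> j"
  have "max (a n i) (a n j) < min (b n i) (b n j)"
    using assms(4,5) gap_bounds(3)[OF assms(1,2)] by auto
  then obtain y where "max (a n i) (a n j) < y" "y < min (b n i) (b n j)"
    using dense by blast
  then have "y \<in> open_interval n i \<inter> open_interval n j" by simp
  then show False using open_intervals_disjoint[OF assms(1-3)] \<open>i \<noteq> j\<close> by blast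
qed

lemma Ix_nonempty:
  assumes "Ix 1 \<noteq> {}" "1 \<le> n"
  shows "Ix n \<noteq> {}"
  using assms(2)
proof (induction n rule: dec_induct)
  case base
  then show ?case using assms(1) by simp
next
  case (step n)
  then obtain i where i: "i \<in> Ix n" by blast
  then have left: "a n i \<in> interval n i"
    using gap_bounds(3)[OF step(1)] by (simp add: less_imp_le)
  have "a n i \<notin> gap n j" if j: "j \<in> Ix n" for j
  proof
    assume "a n i \<in> gap n j"
    then have "a n i \<in> open_interval n j"
      using gap_subset_open_interval[OF step(1) j] by blast
    with open_interval_meets_interval_imp_eq[OF step(1) i j left] show False
      by simp
  qed
  then have "a n i \<in> stage (Suc n)"
    using stage_Suc[OF step(1)] i left by auto
  then show ?case by blast
qed

lemma countable_Ix:
  assumes "1 \<le> n"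
  shows "countable (Ix n)"
proof (rule countable_image_inj_on)
  show "countable (open_interval n ` Ix n)"
    by (rule countable_disjoint_open_subsets)
      (use open_intervals_disjoint[OF assms] in \<open>auto simp: pairwise_def disjnt_def\<close>)
  show "inj_on (open_interval n) (Ix n)"
  proof (rule inj_onI)
    fix i j assume "i \<in> Ix n" "j \<in> Ix n" "open_interval n i = open_interval n j"
    then show "i = j"
      using open_intervals_disjoint[OF assms, of i j] gap_bounds(3)[OF assms, of j] by auto
  qed
qed

lemma cantor_set_borel: "cantor_set Ix a b \<in> sets borel"
  unfolding cantor_set_def
  by (intro sets.countable_INT'' sets.countable_UN'' countable_Ix) auto

definition descendants :: "nat \<Rightarrow> 'i \<Rightarrow> nat \<Rightarrow> 'i set" where
  "descendants N r n = {i \<in> Ix n. interval n i \<subseteq> interval N r}"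

lemma interval_Diff_gaps_subset_cantor_set:
  assumes "1 \<le> N" "r \<in> Ix N"
  shows "interval N r - (\<Union>n\<in>{N..}. \<Union>i\<in>descendants N r n. gap n i) \<subseteq> cantor_set Ix a b"
proof
  fix x
  assume x: "x \<in> interval N r - (\<Union>n\<in>{N..}. \<Union>i\<in>descendants N r n. gap n i)"
  have later: "x \<in> stage n" if "N \<le> n" for n
    using that
  proof (induction n rule: dec_induct)
    case base
    then show ?case using assms x by auto
  next
    case (step n)
    have n: "1 \<le> n" using step(1) assms(1) by simp
    have "x \<notin> gap n i" if i: "i \<in> Ix n" for i
    proof
      assume gap: "x \<in> gap n i"
      obtain j where j: "j \<in> Ix N" "interval n i \<subseteq> interval N j"
        using interval_ancestor[OF assms(1) step(1) i] by blast
      then have "open_interval n i \<subseteq> open_interval N j"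
        using gap_bounds(3)[OF n i] by auto
      then have "x \<in> open_interval N j"
        using gap gap_subset_open_interval[OF n i] by blast
      then have "r = j"
        using open_interval_meets_interval_imp_eq[OF assms j(1)] x by blast
      then show False
        using x gap i j(2) step(1) by (auto simp: descendants_def)
    qed
    with step.IH show ?case
      unfolding stage_Suc[OF n] by blast
  qed
  have "x \<in> stage n" if "1 \<le> n" for n
    using stage_antimono[OF that max.cobounded1[of n N]] later[OF max.cobounded2[of N n]] by blast
  then show "x \<in> cantor_set Ix a b"
    by (auto simp: cantor_set_def)
qed

lemma countable_descendants: "1 \<le> n \<Longrightarrow> countable (descendants N r n)"
  unfolding descendants_def by (rule countable_subset[OF _ countable_Ix]) blast

lemma emeasure_descendant_gaps_le:
  assumes sets: "sets M = sets borel" and n: "1 \<le> n"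
    and portion: "\<And>i. i \<in> Ix n \<Longrightarrow> emeasure M (gap n i) \<le> \<beta> * emeasure M (open_interval n i)"
  shows "emeasure M (\<Union>i\<in>descendants N r n. gap n i) \<le> \<beta> * emeasure M (interval N r)"
proof (rule emeasure_UN_le_portion[OF countable_descendants[OF n], where V = "open_interval n"])
  show "disjoint_family_on (open_interval n) (descendants N r n)"
    using open_intervals_disjoint[OF n] unfolding disjoint_family_on_def descendants_def by blast
qed (use portion gap_subset_open_interval[OF n] in \<open>auto simp: descendants_def sets subset_eq\<close>)

lemma cantor_set_pos:
  assumes sets: "sets M = sets borel" and "1 \<le> N" "r \<in> Ix N"
    and interval: "0 < emeasure M (interval N r)" "emeasure M (interval N r) < \<infinity>"
    and portion: "\<And>n i. N \<le> n \<Longrightarrow> i \<in> Ix n \<Longrightarrow>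
      emeasure M (gap n i) \<le> ennreal (\<beta> n) * emeasure M (open_interval n i)"
    and \<beta>: "\<And>n. 0 \<le> \<beta> n" "summable \<beta>" "(\<Sum>n. \<beta> (n + N)) < 1"
  shows "0 < emeasure M (cantor_set Ix a b)"
proof -
  define G where "G n = (\<Union>i\<in>descendants N r (n + N). gap (n + N) i)" for n
  have "0 < emeasure M (interval N r - (\<Union>n. G n))"
  proof (rule emeasure_Diff_UN_pos[OF _ interval])
    show "G n \<in> sets M" for n
      unfolding G_def sets using assms(2)
      by (intro sets.countable_UN'' countable_descendants) simp_all
    show "emeasure M (G n) \<le> ennreal (\<beta> (n + N)) * emeasure M (interval N r)" for n
      unfolding G_def using assms(2) portion
      by (intro emeasure_descendant_gaps_le[OF sets]) simp_all
    show "summable (\<lambda>n. \<beta> (n + N))"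
      using \<beta>(2) by (rule summable_ignore_initial_segment)
  qed (use \<beta> in \<open>simp_all add: sets\<close>)
  also have "\<dots> \<le> emeasure M (cantor_set Ix a b)"
  proof (rule emeasure_mono)
    have "(\<Union>n\<in>{N..}. \<Union>i\<in>descendants N r n. gap n i) \<subseteq> (\<Union>n. G n)"
    proof (intro UN_least)
      fix n i
      assume "n \<in> {N..}" "i \<in> descendants N r n"
      then have "gap n i \<subseteq> G (n - N)"
        by (auto simp: G_def)
      then show "gap n i \<subseteq> (\<Union>n. G n)" by blast
    qed
    then show "interval N r - (\<Union>n. G n) \<subseteq> cantor_set Ix a b"
      by (rule order_trans[OF Diff_mono[OF order_refl]
            interval_Diff_gaps_subset_cantor_set[OF assms(2,3)]])
  qed (simp add: sets cantor_set_borel)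
  finally show ?thesis .
qed

lemma doubling_measure_cantor_set_pos:
  assumes "doubling_measure M" and "Ix 1 \<noteq> {}"
    and portion: "\<And>n i. 1 \<le> n \<Longrightarrow> i \<in> Ix n \<Longrightarrow> len n i \<le> 1 \<Longrightarrow>
      emeasure M (gap n i) \<le> ennreal (\<beta> n) * emeasure M (open_interval n i)"
    and \<beta>: "\<And>n. 0 \<le> \<beta> n" "summable \<beta>"
  shows "0 < emeasure M (cantor_set Ix a b)"
proof -
  obtain n_short where short: "\<And>n i. n_short \<le> n \<Longrightarrow> i \<in> Ix n \<Longrightarrow> len n i \<le> 1"
    using len_eventually_le[OF zero_less_one] by blast
  obtain n_tail where tail: "\<And>n. n_tail \<le> n \<Longrightarrow> norm (\<Sum>i. \<beta> (i + n)) < 1"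
    using suminf_exist_split[OF zero_less_one \<beta>(2)] by blast
  define N where "N = max 1 (max n_short n_tail)"
  have N: "1 \<le> N" "n_short \<le> N" "n_tail \<le> N"
    by (auto simp: N_def)
  obtain r where r: "r \<in> Ix N"
    using Ix_nonempty[OF assms(2) N(1)] by blast
  show ?thesis
  proof (rule cantor_set_pos[OF _ N(1) r _ _ _ \<beta>])
    show "sets M = sets borel"
      using assms(1) by (simp add: doubling_measure_def)
    show "0 < emeasure M (interval N r)" "emeasure M (interval N r) < \<infinity>"
      using doubling_measure_Icc[OF assms(1) gap_bounds(3)[OF N(1) r]] by auto
    show "emeasure M (gap n i) \<le> ennreal (\<beta> n) * emeasure M (open_interval n i)"
      if "N \<le> n" "i \<in> Ix n" for n i
      using portion[of n i] short[of n i] N that by simp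
    show "(\<Sum>n. \<beta> (n + N)) < 1"
      using tail[OF N(3)] by simp
  qed
qed

end

section \<open>Nice Cantor schemes\<close>

locale centred_cantor_scheme = cantor_scheme Ix a b c d
  for Ix :: "nat \<Rightarrow> 'i set" and a b c d +
  fixes z :: "nat \<Rightarrow> 'i \<Rightarrow> real" and \<eta> :: real
  assumes margin_pos: "0 < \<eta>"
    and centre: "\<And>n i. 1 \<le> n \<Longrightarrow> i \<in> Ix n \<Longrightarrow>
      z n i \<in> gap n i \<inter> {a n i + \<eta> * len n i..b n i - \<eta> * len n i}"
begin

lemma dist_centre_outside:
  assumes "1 \<le> n" "i \<in> Ix n" "x \<notin> open_interval n i"
  shows "\<eta> * len n i \<le> \<bar>z n i - x\<bar>"
  using centre[OF assms(1,2)] assms(3) by auto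

lemma centres_separated:
  assumes "1 \<le> n" "i \<in> Ix n" "1 \<le> m" "j \<in> Ix m" "(n, i) \<noteq> (m, j)"
  shows "\<eta> * min (len n i) (len m j) \<le> \<bar>z n i - z m j\<bar>"
proof -
  have later: "\<eta> * len m j \<le> \<bar>z m j - z n i\<bar>"
    if "1 \<le> n" "n < m" "i \<in> Ix n" "j \<in> Ix m" for n m i j
  proof -
    have "z n i \<notin> interval m j"
      using gap_avoids_later[OF that] centre[of n i] that by blast
    then show ?thesis
      using dist_centre_outside[of m j "z n i"] that by auto
  qed
  have "\<eta> * min (len n i) (len m j) \<le> \<eta> * len n i" "\<eta> * min (len n i) (len m j) \<le> \<eta> * len m j"
    using margin_pos by (auto intro!: mult_left_mono)
  moreover have "\<eta> * len n i \<le> \<bar>z n i - z m j\<bar> \<or> \<eta> * len m j \<le> \<bar>z m j - z n i\<bar>"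
  proof (cases n m rule: linorder_cases)
    case equal
    have "z n j \<in> open_interval n j"
      using centre[of n j] gap_subset_open_interval[of n j] assms(3,4) equal by blast
    then have "z m j \<notin> open_interval n i"
      using open_intervals_disjoint[of n i j] assms equal by blast
    then show ?thesis
      using dist_centre_outside[of n i "z m j"] assms by blast
  qed (use later[of n m i j] later[of m n j i] assms in auto)
  ultimately show ?thesis by linarith
qed

abbreviation scale :: "nat \<Rightarrow> 'i \<Rightarrow> real" where
  "scale n i \<equiv> \<eta> / 2 * len n i"

lemma scale_bounds:
  assumes "1 \<le> n" "i \<in> Ix n"
  shows "0 < scale n i" "scale n i \<le> len n i"
    "z n i \<in> gap n i \<inter> {a n i + scale n i..b n i - scale n i}"
proof -
  show pos: "0 < scale n i"
    using margin_pos gap_bounds(3)[OF assms] by simp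
  have z: "z n i \<in> gap n i" "a n i + \<eta> * len n i \<le> z n i" "z n i \<le> b n i - \<eta> * len n i"
    using centre[OF assms] by simp_all
  then show "scale n i \<le> len n i"
    using pos by linarith
  show "z n i \<in> gap n i \<inter> {a n i + scale n i..b n i - scale n i}"
    using z pos by simp
qed

lemma exists_doubling_measure_gap_le_powr_scale:
  assumes "0 < p"
  shows "\<exists>M K. doubling_measure M \<and> 0 < K \<and> (\<forall>n\<ge>1. \<forall>i\<in>Ix n. len n i \<le> 1 \<longrightarrow>
    emeasure M (gap n i)
      \<le> ennreal (K * ((d n i - c n i) / scale n i) powr p) * emeasure M (open_interval n i))"
proof -
  define T where "T = {(n, i). 1 \<le> n \<and> i \<in> Ix n \<and> len n i \<le> 1}"
  have admissible: "0 < scale n i" "scale n i \<le> 1" "a n i \<le> c n i" "d n i \<le> b n i"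
    "z n i \<in> gap n i \<inter> {a n i + scale n i..b n i - scale n i}" if "(n, i) \<in> T" for n i
    using that scale_bounds[of n i] gap_bounds[of n i] by (auto simp: T_def)
  have "2 * min (\<eta> / 2 * x) (\<eta> / 2 * y) = \<eta> * min x y" for x y
    using margin_pos by (simp add: min_mult_distrib_left)
  then have "pairwise (\<lambda>(n, i) (m, j). 2 * min (scale n i) (scale m j) \<le> \<bar>z n i - z m j\<bar>) T"
    using centres_separated by (auto simp: pairwise_def T_def)
  then have "\<exists>M K. doubling_measure M \<and> 0 < K \<and> (\<forall>(n, i)\<in>T. emeasure M (gap n i)
      \<le> ennreal (K * ((d n i - c n i) / scale n i) powr p) * emeasure M (open_interval n i))"
    using assms admissible
      exists_doubling_measure_thin_on_gaps[where T = T and p = p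
        and L = "\<lambda>(n, i). scale n i" and z = "\<lambda>(n, i). z n i" and a = "\<lambda>(n, i). a n i"
        and b = "\<lambda>(n, i). b n i" and c = "\<lambda>(n, i). c n i" and d = "\<lambda>(n, i). d n i"]
    by (simp add: case_prod_unfold)
  then show ?thesis
    unfolding T_def by blast
qed

lemma thick_imp_powr_scale_le:
  assumes "thick_construction \<alpha> Ix a b c d" "1 \<le> n" "i \<in> Ix n" "0 < p"
  shows "((d n i - c n i) / scale n i) powr p \<le> (2 / \<eta>) powr p * \<alpha> n powr p"
proof -
  have "d n i - c n i \<le> \<alpha> n * len n i"
    using assms(1-3) unfolding thick_construction_def by blast
  then have "(d n i - c n i) / len n i \<le> \<alpha> n"
    using gap_bounds(3)[OF assms(2,3)] by (simp add: pos_divide_le_eq)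
  moreover have pos: "0 < (d n i - c n i) / len n i"
    using gap_nonempty gap_bounds(3) assms(2,3) by simp
  ultimately have "((d n i - c n i) / len n i) powr p \<le> \<alpha> n powr p"
    using assms(4) by (intro powr_mono2) simp_all
  then have "(2 / \<eta>) powr p * ((d n i - c n i) / len n i) powr p \<le> (2 / \<eta>) powr p * \<alpha> n powr p"
    by (intro mult_left_mono) simp_all
  moreover have "(d n i - c n i) / scale n i = 2 / \<eta> * ((d n i - c n i) / len n i)"
    by simp
  ultimately show ?thesis
    using pos margin_pos by (simp only: powr_mult)
qed

lemma exists_doubling_measure_gap_le_powr_thickness:
  assumes "thick_construction \<alpha> Ix a b c d" "0 < p"
  shows "\<exists>M K. doubling_measure M \<and> 0 < K \<and> (\<forall>n\<ge>1. \<forall>i\<in>Ix n. len n i \<le> 1 \<longrightarrow>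
    emeasure M (gap n i) \<le> ennreal (K * \<alpha> n powr p) * emeasure M (open_interval n i))"
proof -
  obtain M K where M: "doubling_measure M" and "0 < K"
    and gap: "\<forall>n\<ge>1. \<forall>i\<in>Ix n. len n i \<le> 1 \<longrightarrow> emeasure M (gap n i)
      \<le> ennreal (K * ((d n i - c n i) / scale n i) powr p) * emeasure M (open_interval n i)"
    using exists_doubling_measure_gap_le_powr_scale[OF assms(2)] by blast
  have "emeasure M (gap n i)
      \<le> ennreal (K * (2 / \<eta>) powr p * \<alpha> n powr p) * emeasure M (open_interval n i)"
    if n: "1 \<le> n" "i \<in> Ix n" and short: "len n i \<le> 1" for n i
  proof -
    have "emeasure M (gap n i)
        \<le> ennreal (K * ((d n i - c n i) / scale n i) powr p) * emeasure M (open_interval n i)"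
      using gap n short by blast
    also have "K * ((d n i - c n i) / scale n i) powr p \<le> K * ((2 / \<eta>) powr p * \<alpha> n powr p)"
      using thick_imp_powr_scale_le[OF assms(1) n assms(2)] \<open>0 < K\<close>
      by (intro mult_left_mono) simp_all
    finally show ?thesis
      by (simp add: mult.assoc ennreal_leI mult_right_mono)
  qed
  moreover have "0 < K * (2 / \<eta>) powr p"
    using \<open>0 < K\<close> margin_pos by simp
  ultimately show ?thesis
    using M by blast
qed

lemma exists_doubling_measure_cantor_set_pos:
  assumes "Ix 1 \<noteq> {}" "thick_construction \<alpha> Ix a b c d" "0 < p" "summable (\<lambda>n. \<alpha> n powr p)"
  shows "\<exists>M. doubling_measure M \<and> 0 < emeasure M (cantor_set Ix a b)"
proof -
  obtain M K where M: "doubling_measure M" and "0 < K"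
    and thin: "\<forall>n\<ge>1. \<forall>i\<in>Ix n. len n i \<le> 1 \<longrightarrow>
      emeasure M (gap n i) \<le> ennreal (K * \<alpha> n powr p) * emeasure M (open_interval n i)"
    using exists_doubling_measure_gap_le_powr_thickness[OF assms(2,3)] by blast
  have "0 < emeasure M (cantor_set Ix a b)"
  proof (rule doubling_measure_cantor_set_pos[OF M assms(1)])
    show "summable (\<lambda>n. K * \<alpha> n powr p)"
      using assms(4) by (rule summable_mult)
  qed (use thin \<open>0 < K\<close> in simp_all)
  then show ?thesis using M by blast
qed

end

lemma nice_construction_centred:
  assumes "cantor_construction Ix a b c d" "nice_construction Ix a b c d"
  shows "\<exists>z \<eta>. centred_cantor_scheme Ix a b c d z \<eta>"
proof -
  obtain t where t: "t < 1" and meet: "\<And>n i. 1 \<le> n \<Longrightarrow> i \<in> Ix n \<Longrightarrow>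
      \<exists>x. x \<in> conc_interval t (a n i) (b n i) \<inter> {c n i<..<d n i}"
    using assms(2) unfolding nice_construction_def by blast
  define \<eta> where "\<eta> = (1 - t) / 2"
  have conc: "conc_interval t x y = {x + \<eta> * (y - x)..y - \<eta> * (y - x)}" for x y
    unfolding conc_interval_def \<eta>_def by (simp add: field_simps)
  define z where "z n i = (SOME x. x \<in> conc_interval t (a n i) (b n i) \<inter> {c n i<..<d n i})" for n i
  have "z n i \<in> conc_interval t (a n i) (b n i) \<inter> {c n i<..<d n i}" if "1 \<le> n" "i \<in> Ix n" for n i
    unfolding z_def by (rule someI_ex[OF meet[OF that]])
  then have centre: "z n i \<in> {c n i<..<d n i} \<inter>
      {a n i + \<eta> * (b n i - a n i)..b n i - \<eta> * (b n i - a n i)}" if "1 \<le> n" "i \<in> Ix n" for n i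
    using that unfolding conc by blast
  have "centred_cantor_scheme Ix a b c d z \<eta>"
  proof
    show "c n i < d n i" if "1 \<le> n" "i \<in> Ix n" for n i
      using centre[OF that] by auto
    show "0 < \<eta>"
      using t by (simp add: \<eta>_def)
  qed (use assms(1) centre in auto)
  then show ?thesis by blast
qed

theorem theorem2p2:
  fixes Ix :: "nat \<Rightarrow> 'i set" and a b c d :: "nat \<Rightarrow> 'i \<Rightarrow> real"
    and \<alpha> :: "nat \<Rightarrow> real" and p :: real
  assumes "cantor_construction Ix a b c d"
    and "Ix 1 \<noteq> {}"
    and "nice_construction Ix a b c d"
    and "thick_construction \<alpha> Ix a b c d"
    and "\<forall>n\<ge>1. 0 < \<alpha> n \<and> \<alpha> n < 1"
    and "0 < p"
    and "summable (\<lambda>n. \<alpha> n powr p)"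
  shows "\<exists>M. doubling_measure M \<and> emeasure M (cantor_set Ix a b) > 0"
proof -
  obtain z \<eta> where "centred_cantor_scheme Ix a b c d z \<eta>"
    using nice_construction_centred[OF assms(1,3)] by blast
  then show ?thesis
    using assms(2,4,6,7) by (rule centred_cantor_scheme.exists_doubling_measure_cantor_set_pos)
qed

end
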